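(* Let $H$ be a finite graph. The up and right graph $U$ is strongly $H$-induced-saturated if and only if all of the following hold: (1) $H$ is not a permutation graph; (2) there exists an edge $e$ of $H$ such that $H-e$ is a permutation graph; (3) there exists a non-edge $\overline{e}$ of $H$ (a pair of distinct non-adjacent vertices) such that $H+\overline{e}$ is a permutation graph.
   Context: The up and right graph $U$ has vertex set $\mathbb{Q}\times\mathbb{Q}$, and distinct vertices $(q,r)$ and $(s,t)$ are adjacent if and only if either ($q+r\sqrt2<s+t\sqrt2$ and $q-r\sqrt2<s-t\sqrt2$) or ($q+r\sqrt2>s+t\sqrt2$ and $q-r\sqrt2>s-t\sqrt2$). A finite graph on vertices $v_1,\dots,v_n$ is a permutation graph if there is a permutation $\sigma$ of $\{1,\dots,n\}$ such that for all $i<j$, $v_iv_j$ is an edge if and only if $\sigma(i)<\sigma(j)$ (for some labelling of the vertices). Graphs are simple with countable vertex sets; $H$-free means containing no induced copy of $H$. Perturbing a pair of distinct vertices $u,v$ means deleting $uv$ if it is an edge and adding it otherwise; a locally finite perturbation of $G$ is obtained by perturbing a nonempty set of pairs such that each vertex lies in finitely many perturbed pairs. A graph $G$ is strongly $H$-induced-saturated if $G$ is $H$-free but every locally finite perturbation of $G$ contains an induced copy of $H$. *)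

theory Defs
  imports Complex_Main "HOL-Library.Countable_Set" "HOL-Combinatorics.Permutations"
begin

record 'v graph =
  verts :: "'v set"
  edges :: "'v set set"

definition vertex_pairs :: "'v graph \<Rightarrow> 'v set set" where
  "vertex_pairs G = {{u, v} | u v. u \<in> verts G \<and> v \<in> verts G \<and> u \<noteq> v}"

definition simple_graph :: "'v graph \<Rightarrow> bool" where
  "simple_graph G \<longleftrightarrow> countable (verts G) \<and> edges G \<subseteq> vertex_pairs G"

definition finite_graph :: "'v graph \<Rightarrow> bool" where
  "finite_graph G \<longleftrightarrow> simple_graph G \<and> finite (verts G)"

definition delete_edge :: "'v graph \<Rightarrow> 'v set \<Rightarrow> 'v graph" where
  "delete_edge G e = \<lparr>verts = verts G, edges = edges G - {e}\<rparr>"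

definition add_edge :: "'v graph \<Rightarrow> 'v set \<Rightarrow> 'v graph" where
  "add_edge G e = \<lparr>verts = verts G, edges = insert e (edges G)\<rparr>"

definition induced_subgraph :: "'v graph \<Rightarrow> 'v set \<Rightarrow> 'v graph" where
  "induced_subgraph G S = \<lparr>verts = S, edges = {e \<in> edges G. e \<subseteq> S}\<rparr>"

definition isomorphic :: "'v graph \<Rightarrow> 'w graph \<Rightarrow> bool" where
  "isomorphic G H \<longleftrightarrow>
     (\<exists>f. bij_betw f (verts G) (verts H) \<and>
          (\<forall>u\<in>verts G. \<forall>v\<in>verts G. {u, v} \<in> edges G \<longleftrightarrow> {f u, f v} \<in> edges H))"

definition contains_induced_copy :: "'v graph \<Rightarrow> 'h graph \<Rightarrow> bool" where
  "contains_induced_copy G H \<longleftrightarrow>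
     (\<exists>S \<subseteq> verts G. isomorphic H (induced_subgraph G S))"

definition induced_free :: "'h graph \<Rightarrow> 'v graph \<Rightarrow> bool" where
  "induced_free H G \<longleftrightarrow> \<not> contains_induced_copy G H"

definition perturb :: "'v graph \<Rightarrow> 'v set set \<Rightarrow> 'v graph" where
  "perturb G P = \<lparr>verts = verts G, edges = (edges G - P) \<union> (P - edges G)\<rparr>"

definition locally_finite_perturbation :: "'v graph \<Rightarrow> 'v graph \<Rightarrow> bool" where
  "locally_finite_perturbation G G' \<longleftrightarrow>
     (\<exists>P \<subseteq> vertex_pairs G. P \<noteq> {} \<and> (\<forall>v\<in>verts G. finite {e \<in> P. v \<in> e}) \<and> G' = perturb G P)"

definition strongly_induced_saturated :: "'h graph \<Rightarrow> 'v graph \<Rightarrow> bool" where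
  "strongly_induced_saturated H G \<longleftrightarrow>
     induced_free H G \<and>
     (\<forall>G'. locally_finite_perturbation G G' \<longrightarrow> contains_induced_copy G' H)"

text \<open>
  Edges correspond to non-inversions of the permutation. Many authors use inversions instead;
  reversing the permutation shows that the two conventions define the same class of graphs.
\<close>

definition permutation_graph :: "'v graph \<Rightarrow> bool" where
  "permutation_graph G \<longleftrightarrow>
     (let n = card (verts G) in
      \<exists>(v :: nat \<Rightarrow> 'v) (\<sigma> :: nat \<Rightarrow> nat).
        bij_betw v {1..n} (verts G) \<and> \<sigma> permutes {1..n} \<and>
        (\<forall>i\<in>{1..n}. \<forall>j\<in>{1..n}. i < j \<longrightarrow> ({v i, v j} \<in> edges G \<longleftrightarrow> \<sigma> i < \<sigma> j)))"

definition up_right_adjacent :: "rat \<times> rat \<Rightarrow> rat \<times> rat \<Rightarrow> bool" where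
  "up_right_adjacent x y \<longleftrightarrow>
     (case (x, y) of ((q, r), (s, t)) \<Rightarrow>
        (of_rat q + of_rat r * sqrt 2 < of_rat s + of_rat t * sqrt 2 \<and>
         of_rat q - of_rat r * sqrt 2 < of_rat s - of_rat t * sqrt 2) \<or>
        (of_rat q + of_rat r * sqrt 2 > of_rat s + of_rat t * sqrt 2 \<and>
         of_rat q - of_rat r * sqrt 2 > of_rat s - of_rat t * sqrt 2))"

definition up_right_graph :: "(rat \<times> rat) graph" where
  "up_right_graph =
     \<lparr>verts = UNIV, edges = {{x, y} | x y. x \<noteq> y \<and> up_right_adjacent x y}\<rparr>"

lemma up_right_adjacent_commute: "up_right_adjacent x y \<longleftrightarrow> up_right_adjacent y x"
  unfolding up_right_adjacent_def by (auto split: prod.splits)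

lemma edge_up_right_graph_iff:
  "{x, y} \<in> edges up_right_graph \<longleftrightarrow> x \<noteq> y \<and> up_right_adjacent x y"
proof -
  have "{x, y} \<in> edges up_right_graph \<longleftrightarrow>
          (\<exists>a b. {x, y} = {a, b} \<and> a \<noteq> b \<and> up_right_adjacent a b)"
    by (simp add: up_right_graph_def)
  also have "\<dots> \<longleftrightarrow> x \<noteq> y \<and> up_right_adjacent x y"
    unfolding doubleton_eq_iff using up_right_adjacent_commute by metis
  finally show ?thesis .
qed

lemma simple_graph_up_right_graph: "simple_graph up_right_graph"
  by (auto simp: simple_graph_def up_right_graph_def vertex_pairs_def)

lemma simple_graph_perturb:
  assumes "simple_graph G" "P \<subseteq> vertex_pairs G"
  shows "simple_graph (perturb G P)"
  using assms by (auto simp: simple_graph_def perturb_def vertex_pairs_def)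

end

theory Submission
  imports Defs
begin

text \<open>
  A finite graph is a permutation graph iff its vertices can be placed in the plane, with distinct
  first and distinct second coordinates, so that edges are the pairs of positive slope. The map
  sending \<open>(q, r)\<close> to \<open>(q + r\<surd>2, q - r\<surd>2)\<close> realises \<open>U\<close> in this way on a dense set of points, so the
  finite induced subgraphs of \<open>U\<close> are exactly the permutation graphs. If \<open>P\<close> is a locally finite set
  of perturbed pairs and \<open>{x, y} \<in> P\<close>, affine maps of the two axes move any prescribed pair of a
  placed graph with the matching slope sign to \<open>x\<close>, \<open>y\<close>; density then allows the other vertices to be
  chosen one at a time near their targets, avoiding the finitely many points that would create
  another perturbed pair.
\<close>

section \<open>Plane placements, slope signs and their stability under small moves\<close>

definition concordant :: "('v \<Rightarrow> real) \<Rightarrow> ('v \<Rightarrow> real) \<Rightarrow> 'v \<Rightarrow> 'v \<Rightarrow> bool" where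
  "concordant p q u v \<longleftrightarrow> 0 < (p u - p v) * (q u - q v)"

lemma concordant_iff:
  "concordant p q u v \<longleftrightarrow> (p u < p v \<and> q u < q v) \<or> (p v < p u \<and> q v < q u)"
  by (auto simp: concordant_def zero_less_mult_iff)

text \<open>Half of the smallest gap between values serves as the radius of the boxes in which
  points may later be moved without changing the order of any two.\<close>

lemma finite_inj_on_separated:
  fixes p :: "'a \<Rightarrow> real"
  assumes "finite V" "inj_on p V"
  obtains \<epsilon> where "\<epsilon> > 0" "\<And>u v. u \<in> V \<Longrightarrow> v \<in> V \<Longrightarrow> u \<noteq> v \<Longrightarrow> 2 * \<epsilon> \<le> \<bar>p u - p v\<bar>"
proof -
  \<comment> \<open>The extra element 1 keeps \<open>Min\<close> meaningful when \<open>V\<close>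
    has fewer than two elements.\<close>
  let ?D = "insert 1 ((\<lambda>(u, v). \<bar>p u - p v\<bar>) ` {(u, v) \<in> V \<times> V. u \<noteq> v})"
  have fin: "finite ?D"
    using assms(1) by (auto intro: finite_subset[of _ "V \<times> V"])
  have "0 < Min ?D"
    using fin assms(2) by (subst Min_gr_iff) (auto simp: inj_on_def)
  moreover have "Min ?D \<le> \<bar>p u - p v\<bar>" if "u \<in> V" "v \<in> V" "u \<noteq> v" for u v
    using fin that by (intro Min_le) auto
  ultimately show ?thesis
    using that[of "Min ?D / 2"] by simp
qed

text \<open>Two reals at least \<open>2 * \<epsilon>\<close> apart keep their order when each moves
  by less than \<open>\<epsilon>\<close>, so both factors of the slope sign are preserved.\<close>

lemma concordant_cong_near:
  assumes "\<bar>p u - p' u\<bar> < \<epsilon>" "\<bar>p v - p' v\<bar> < \<epsilon>" "2 * \<epsilon> \<le> \<bar>p u - p v\<bar>"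
    and "\<bar>q u - q' u\<bar> < \<epsilon>" "\<bar>q v - q' v\<bar> < \<epsilon>" "2 * \<epsilon> \<le> \<bar>q u - q v\<bar>"
  shows "concordant p' q' u v \<longleftrightarrow> concordant p q u v"
proof -
  have "p' u < p' v \<longleftrightarrow> p u < p v" "p' v < p' u \<longleftrightarrow> p v < p u"
    using assms(1-3) by linarith+
  moreover have "q' u < q' v \<longleftrightarrow> q u < q v" "q' v < q' u \<longleftrightarrow> q v < q u"
    using assms(4-6) by linarith+
  ultimately show ?thesis
    by (simp add: concordant_iff)
qed

section \<open>Permutation graphs as graphs of plane placements\<close>

definition rank_in :: "'a set \<Rightarrow> ('a \<Rightarrow> real) \<Rightarrow> 'a \<Rightarrow> nat" where
  "rank_in V p u = card {w \<in> V. p w \<le> p u}"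

lemma rank_in_less_iff:
  assumes "finite V" "u \<in> V" "v \<in> V"
  shows "rank_in V p u < rank_in V p v \<longleftrightarrow> p u < p v"
proof
  assume "p u < p v"
  then have "{w \<in> V. p w \<le> p u} \<subset> {w \<in> V. p w \<le> p v}"
    using assms by force
  then show "rank_in V p u < rank_in V p v"
    using assms(1) unfolding rank_in_def by (intro psubset_card_mono) auto
next
  assume less: "rank_in V p u < rank_in V p v"
  show "p u < p v"
  proof (rule ccontr)
    assume "\<not> p u < p v"
    then have "{w \<in> V. p w \<le> p v} \<subseteq> {w \<in> V. p w \<le> p u}"
      by auto
    then have "rank_in V p v \<le> rank_in V p u"
      using assms(1) unfolding rank_in_def by (intro card_mono) auto
    with less show False by simp
  qed
qed

text \<open>Counting with \<open>\<le>\<close> includes the element itself, so ranks start at 1 and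
  match the index set \<open>{1..n}\<close> in \<open>permutation_graph\<close>.\<close>

lemma bij_betw_rank_in:
  assumes "finite V" "inj_on p V"
  shows "bij_betw (rank_in V p) V {1..card V}"
proof -
  have inj: "inj_on (rank_in V p) V"
  proof (rule inj_onI)
    fix u v assume uv: "u \<in> V" "v \<in> V" "rank_in V p u = rank_in V p v"
    then have "p u = p v"
      using rank_in_less_iff[OF assms(1), of u v p] rank_in_less_iff[OF assms(1), of v u p] by auto
    with uv assms(2) show "u = v" by (simp add: inj_on_eq_iff)
  qed
  have "rank_in V p ` V \<subseteq> {1..card V}"
  proof clarify
    fix u assume "u \<in> V"
    then have "{w \<in> V. p w \<le> p u} \<noteq> {}" by auto
    then have "rank_in V p u \<noteq> 0"
      using assms(1) by (simp add: rank_in_def)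
    moreover have "rank_in V p u \<le> card V"
      unfolding rank_in_def using assms(1) by (intro card_mono) auto
    ultimately show "rank_in V p u \<in> {1..card V}" by simp
  qed
  moreover have "card (rank_in V p ` V) = card {1..card V}"
    by (simp add: card_image inj)
  ultimately have "rank_in V p ` V = {1..card V}"
    by (intro card_subset_eq) auto
  with inj show ?thesis
    by (simp add: bij_betw_def)
qed

text \<open>From a permutation, a vertex gets its label and the \<open>\<sigma>\<close>-image of its
  label as coordinates. Conversely, vertices are listed by increasing \<open>p\<close>, and
  \<open>\<sigma>\<close> sends the \<open>p\<close>-rank of a vertex to its
  \<open>q\<close>-rank.\<close>

lemma permutation_graph_iff_concordant:
  fixes G :: "'v graph"
  assumes fin: "finite (verts G)"
  shows "permutation_graph G \<longleftrightarrow>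
    (\<exists>p q. inj_on p (verts G) \<and> inj_on q (verts G) \<and>
      (\<forall>u\<in>verts G. \<forall>v\<in>verts G. u \<noteq> v \<longrightarrow> ({u, v} \<in> edges G \<longleftrightarrow> concordant p q u v)))"
    (is "_ \<longleftrightarrow> ?R")
proof
  let ?n = "card (verts G)"
  assume "permutation_graph G"
  then obtain x \<sigma> where x: "bij_betw x {1..?n} (verts G)" and \<sigma>: "\<sigma> permutes {1..?n}"
    and e: "\<And>i j. i \<in> {1..?n} \<Longrightarrow> j \<in> {1..?n} \<Longrightarrow> i < j \<Longrightarrow> {x i, x j} \<in> edges G \<longleftrightarrow> \<sigma> i < \<sigma> j"
    unfolding permutation_graph_def Let_def by metis
  define y where "y = inv_into {1..?n} x"
  have y: "bij_betw y (verts G) {1..?n}"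
    unfolding y_def by (rule bij_betw_inv_into[OF x])
  have yin: "y u \<in> {1..?n}" if "u \<in> verts G" for u
    using bij_betwE[OF y] that by blast
  have xy: "x (y u) = u" if "u \<in> verts G" for u
    unfolding y_def using bij_betw_inv_into_right[OF x that] .
  have inj: "inj_on y (verts G)"
    using y by (simp add: bij_betw_def)
  have "{u, v} \<in> edges G \<longleftrightarrow> concordant (\<lambda>u. real (y u)) (\<lambda>u. real (\<sigma> (y u))) u v"
    if uv: "u \<in> verts G" "v \<in> verts G" "u \<noteq> v" for u v
  proof (cases "y u < y v")
    case True
    then show ?thesis
      using e[of "y u" "y v"] yin[OF uv(1)] yin[OF uv(2)] xy[OF uv(1)] xy[OF uv(2)]
      by (auto simp: concordant_iff)
  next
    case False
    moreover have "y u \<noteq> y v"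
      using inj uv by (simp add: inj_on_eq_iff)
    ultimately have "y v < y u" by simp
    then show ?thesis
      using e[of "y v" "y u"] yin[OF uv(1)] yin[OF uv(2)] xy[OF uv(1)] xy[OF uv(2)]
      by (auto simp: concordant_iff insert_commute)
  qed
  moreover have "inj_on (\<lambda>u. real (y u)) (verts G)" "inj_on (\<lambda>u. real (\<sigma> (y u))) (verts G)"
    using inj permutes_inj[OF \<sigma>] by (auto simp: inj_on_def)
  ultimately show ?R by blast
next
  let ?V = "verts G" and ?n = "card (verts G)"
  assume ?R
  then obtain p q where p: "inj_on p ?V" and q: "inj_on q ?V"
    and e: "\<And>u v. u \<in> ?V \<Longrightarrow> v \<in> ?V \<Longrightarrow> u \<noteq> v \<Longrightarrow> {u, v} \<in> edges G \<longleftrightarrow> concordant p q u v"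
    by blast
  define x where "x = inv_into ?V (rank_in ?V p)"
  \<comment> \<open>Being the identity off \<open>{1..?n}\<close> is part of
    \<open>permutes\<close>.\<close>
  define \<sigma> where "\<sigma> i = (if i \<in> {1..?n} then rank_in ?V q (x i) else i)" for i
  have x: "bij_betw x {1..?n} ?V"
    unfolding x_def by (rule bij_betw_inv_into[OF bij_betw_rank_in[OF fin p]])
  have xin: "x i \<in> ?V" if "i \<in> {1..?n}" for i
    using bij_betwE[OF x] that by blast
  have rx: "rank_in ?V p (x i) = i" if "i \<in> {1..?n}" for i
    unfolding x_def using bij_betw_inv_into_right[OF bij_betw_rank_in[OF fin p] that] .
  have "bij_betw \<sigma> {1..?n} {1..?n}"
    using bij_betw_trans[OF x bij_betw_rank_in[OF fin q]]
    by (rule bij_betw_cong[THEN iffD1, rotated]) (simp add: \<sigma>_def)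
  then have "\<sigma> permutes {1..?n}"
    by (rule bij_imp_permutes) (auto simp: \<sigma>_def)
  moreover have "{x i, x j} \<in> edges G \<longleftrightarrow> \<sigma> i < \<sigma> j"
    if ij: "i \<in> {1..?n}" "j \<in> {1..?n}" "i < j" for i j
  proof -
    have "p (x i) < p (x j)"
      using rank_in_less_iff[OF fin xin[OF ij(1)] xin[OF ij(2)], of p] rx ij by simp
    moreover from this have "x i \<noteq> x j" by auto
    moreover have "\<sigma> i < \<sigma> j \<longleftrightarrow> q (x i) < q (x j)"
      using rank_in_less_iff[OF fin xin[OF ij(1)] xin[OF ij(2)], of q] ij by (simp add: \<sigma>_def)
    ultimately show ?thesis
      using e[OF xin[OF ij(1)] xin[OF ij(2)]] by (auto simp: concordant_iff)
  qed
  ultimately show "permutation_graph G"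
    unfolding permutation_graph_def Let_def using x by blast
qed

section \<open>Induced copies as injective vertex maps\<close>

lemma contains_induced_copy_iff:
  "contains_induced_copy G H \<longleftrightarrow>
    (\<exists>f. inj_on f (verts H) \<and> f ` verts H \<subseteq> verts G \<and>
      (\<forall>u\<in>verts H. \<forall>v\<in>verts H. {u, v} \<in> edges H \<longleftrightarrow> {f u, f v} \<in> edges G))"
    (is "_ \<longleftrightarrow> ?R")
proof
  assume "contains_induced_copy G H"
  then obtain S f where "S \<subseteq> verts G" and f: "bij_betw f (verts H) S"
    "\<And>u v. u \<in> verts H \<Longrightarrow> v \<in> verts H \<Longrightarrow>
      {u, v} \<in> edges H \<longleftrightarrow> {f u, f v} \<in> edges G \<and> {f u, f v} \<subseteq> S"
    unfolding contains_induced_copy_def isomorphic_def induced_subgraph_def by auto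
  moreover have "{f u, f v} \<subseteq> S" if "u \<in> verts H" "v \<in> verts H" for u v
    using bij_betwE[OF f(1)] that by blast
  ultimately show ?R
    unfolding bij_betw_def by (intro exI[of _ f]) simp
next
  assume ?R
  then obtain f where f: "inj_on f (verts H)" "f ` verts H \<subseteq> verts G"
    "\<And>u v. u \<in> verts H \<Longrightarrow> v \<in> verts H \<Longrightarrow> {u, v} \<in> edges H \<longleftrightarrow> {f u, f v} \<in> edges G"
    by blast
  then have "isomorphic H (induced_subgraph G (f ` verts H))"
    unfolding isomorphic_def induced_subgraph_def
    by (intro exI[of _ f]) (simp add: bij_betw_def)
  with f(2) show "contains_induced_copy G H"
    unfolding contains_induced_copy_def by blast
qed

lemma vertex_pairs_doubleton_iff:
  "{u, v} \<in> vertex_pairs G \<longleftrightarrow> u \<in> verts G \<and> v \<in> verts G \<and> u \<noteq> v"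
  by (auto simp: vertex_pairs_def doubleton_eq_iff)

text \<open>Only distinct vertices have to be compared: for \<open>u = v\<close> both sides fail,
  since simple graphs have no loops.\<close>

lemma contains_induced_copyI:
  assumes "simple_graph G" "simple_graph H" "inj_on f (verts H)" "f ` verts H \<subseteq> verts G"
    and "\<And>u v. u \<in> verts H \<Longrightarrow> v \<in> verts H \<Longrightarrow> u \<noteq> v \<Longrightarrow> {u, v} \<in> edges H \<longleftrightarrow> {f u, f v} \<in> edges G"
  shows "contains_induced_copy G H"
proof -
  have "{u, u} \<notin> edges H" "{u', u'} \<notin> edges G" for u u'
    using assms(1,2) vertex_pairs_doubleton_iff[of u u H] vertex_pairs_doubleton_iff[of u' u' G]
    unfolding simple_graph_def by blast+
  then show ?thesis
    unfolding contains_induced_copy_iff using assms(3-5) by metis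
qed

section \<open>The two conjugate coordinates of \<open>U\<close>: injectivity and density\<close>

definition sum_coord :: "rat \<times> rat \<Rightarrow> real" where
  "sum_coord z = of_rat (fst z) + of_rat (snd z) * sqrt 2"

definition diff_coord :: "rat \<times> rat \<Rightarrow> real" where
  "diff_coord z = of_rat (fst z) - of_rat (snd z) * sqrt 2"

lemma up_right_adjacent_iff_concordant:
  "up_right_adjacent x y \<longleftrightarrow> concordant sum_coord diff_coord x y"
  by (auto simp: up_right_adjacent_def concordant_iff sum_coord_def diff_coord_def
      split: prod.splits)

lemma edge_up_right_graph_iff_concordant:
  "{x, y} \<in> edges up_right_graph \<longleftrightarrow> concordant sum_coord diff_coord x y"
  unfolding edge_up_right_graph_iff up_right_adjacent_iff_concordant
  by (auto simp: concordant_iff)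

lemma rat_square_neq_2: "(x :: rat)\<^sup>2 \<noteq> 2"
proof
  assume x: "x\<^sup>2 = 2"
  obtain a b where ab: "quotient_of x = (a, b)" by fastforce
  then have b: "b > 0" and cop: "coprime a b" and xab: "x = of_int a / of_int b"
    by (auto intro: quotient_of_denom_pos quotient_of_coprime quotient_of_div)
  have "(of_int a)\<^sup>2 = (2 * (of_int b)\<^sup>2 :: rat)"
    using x b unfolding xab by (simp add: power_divide field_simps)
  then have eq: "a\<^sup>2 = 2 * b\<^sup>2"
    by (metis of_int_eq_iff of_int_mult of_int_numeral of_int_power)
  then have "even a" by (metis dvd_triv_left even_power)
  then obtain c where "a = 2 * c" by auto
  with eq have "b\<^sup>2 = 2 * c\<^sup>2" by (simp add: power2_eq_square)
  then have "even b" by (metis dvd_triv_left even_power)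
  with \<open>even a\<close> cop show False
    by (metis coprime_common_divisor odd_one)
qed

text \<open>With \<open>r\<close> nonzero, squaring would make \<open>q / r\<close> a rational
  square root of 2.\<close>

lemma rat_add_sqrt2_eq_0:
  assumes "of_rat q + of_rat r * sqrt 2 = 0"
  shows "q = 0 \<and> r = 0"
proof (cases "r = 0")
  case False
  have "(of_rat q)\<^sup>2 = (of_rat r * sqrt 2)\<^sup>2"
    using assms by (simp add: eq_neg_iff_add_eq_0[symmetric])
  then have "(of_rat (q\<^sup>2) :: real) = of_rat (2 * r\<^sup>2)"
    by (simp add: power_mult_distrib of_rat_power of_rat_mult)
  then have "q\<^sup>2 = 2 * r\<^sup>2"
    by (simp only: of_rat_eq_iff)
  then have "(q / r)\<^sup>2 = 2"
    using False by (simp add: power_divide)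
  then show ?thesis
    using rat_square_neq_2 by blast
qed (use assms in simp)

text \<open>Together with \<open>inj_diff_coord\<close> this says that distinct points of
  \<open>U\<close> never share a coordinate, so no pair has a vanishing slope product.\<close>

lemma inj_sum_coord: "inj sum_coord"
proof (rule injI)
  fix x y assume "sum_coord x = sum_coord y"
  then have "of_rat (fst x - fst y) + of_rat (snd x - snd y) * sqrt 2 = 0"
    by (simp add: sum_coord_def of_rat_diff algebra_simps)
  from rat_add_sqrt2_eq_0[OF this] show "x = y"
    by (simp add: prod_eq_iff)
qed

lemma inj_diff_coord: "inj diff_coord"
proof (rule injI)
  fix x y assume "diff_coord x = diff_coord y"
  then have "of_rat (fst x - fst y) + of_rat (snd y - snd x) * sqrt 2 = 0"
    by (simp add: diff_coord_def of_rat_diff algebra_simps)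
  from rat_add_sqrt2_eq_0[OF this] show "x = y"
    by (simp add: prod_eq_iff)
qed

text \<open>The target \<open>(s, t)\<close> is hit exactly by first component \<open>c\<close> and
  second component \<open>d / sqrt 2\<close>. A rational \<open>r\<close> is fixed near the latter
  and the first component runs through a rational interval around \<open>c\<close>. Infinitely many
  points, not just one, are wanted because finitely many will be excluded.\<close>

lemma infinite_up_right_box:
  assumes "\<epsilon> > 0"
  shows "infinite {z. \<bar>s - sum_coord z\<bar> < \<epsilon> \<and> \<bar>t - diff_coord z\<bar> < \<epsilon>}"
proof -
  define c where "c = (s + t) / 2"
  define d where "d = (s - t) / 2"
  have s: "s = c + d" and t: "t = c - d"
    by (simp_all add: c_def d_def field_simps)
  obtain r where r: "(d - \<epsilon> / 2) / sqrt 2 < of_rat r" "of_rat r < (d + \<epsilon> / 2) / sqrt 2"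
    using of_rat_dense[of "(d - \<epsilon> / 2) / sqrt 2" "(d + \<epsilon> / 2) / sqrt 2"] assms
    by (auto simp: divide_strict_right_mono)
  obtain q1 where q1: "c - \<epsilon> / 2 < of_rat q1" "of_rat q1 < c"
    using of_rat_dense[of "c - \<epsilon> / 2" c] assms by auto
  obtain q2 where q2: "c < of_rat q2" "of_rat q2 < c + \<epsilon> / 2"
    using of_rat_dense[of c "c + \<epsilon> / 2"] assms by auto
  have "of_rat q1 < (of_rat q2 :: real)"
    using q1 q2 by linarith
  then have "infinite {q1<..<q2}"
    by (intro infinite_Ioo) (simp add: of_rat_less)
  then have "infinite ((\<lambda>q. (q, r)) ` {q1<..<q2})"
    by (simp add: finite_image_iff inj_on_def)
  moreover have "(\<lambda>q. (q, r)) ` {q1<..<q2} \<subseteq> {z. \<bar>s - sum_coord z\<bar> < \<epsilon> \<and> \<bar>t - diff_coord z\<bar> < \<epsilon>}"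
  proof clarsimp
    fix q assume "q1 < q" "q < q2"
    then have "of_rat q1 < (of_rat q :: real)" "of_rat q < (of_rat q2 :: real)"
      by (simp_all add: of_rat_less)
    then have "\<bar>c - of_rat q\<bar> < \<epsilon> / 2"
      using q1 q2 by linarith
    moreover have "d - \<epsilon> / 2 < of_rat r * sqrt 2" "of_rat r * sqrt 2 < d + \<epsilon> / 2"
      using r by (simp_all add: pos_divide_less_eq pos_less_divide_eq)
    ultimately show "\<bar>s - sum_coord (q, r)\<bar> < \<epsilon> \<and> \<bar>t - diff_coord (q, r)\<bar> < \<epsilon>"
      unfolding s t sum_coord_def diff_coord_def fst_conv snd_conv by linarith
  qed
  ultimately show ?thesis
    using finite_subset by blast
qed

section \<open>Placing a finite graph in \<open>U\<close> away from perturbed pairs\<close>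

lemma finite_perturbed_neighbours:
  assumes "finite {e \<in> P. x \<in> e}" "\<And>e. e \<in> P \<Longrightarrow> finite e"
  shows "finite {z. {x, z} \<in> P}"
  using finite_subset[of "{z. {x, z} \<in> P}" "\<Union>{e \<in> P. x \<in> e}"] assms by auto

text \<open>Induction on \<open>W\<close>: the points already placed forbid only finitely many
  positions for the next vertex, while its box is infinite. The vertices of \<open>A\<close> are
  pinned in advance, and pairs inside \<open>A\<close> stay unrestricted so that a chosen perturbed
  pair can sit there.\<close>

lemma placement_avoiding_pairs:
  fixes p q :: "'v \<Rightarrow> real" and f\<^sub>0 :: "'v \<Rightarrow> rat \<times> rat"
  assumes "finite W" "finite A" "A \<inter> W = {}" "\<epsilon> > 0"
    and lf: "\<And>x. finite {z. {x, z} \<in> P}"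
  shows "\<exists>f. (\<forall>u\<in>A. f u = f\<^sub>0 u) \<and>
    (\<forall>u\<in>W. \<bar>p u - sum_coord (f u)\<bar> < \<epsilon> \<and> \<bar>q u - diff_coord (f u)\<bar> < \<epsilon>) \<and>
    (\<forall>u\<in>W. \<forall>v\<in>A \<union> W. u \<noteq> v \<longrightarrow> {f u, f v} \<notin> P)"
  using assms(1,3)
proof (induction W)
  case empty
  then show ?case by auto
next
  case (insert w W)
  then have "A \<inter> W = {}" by auto
  from insert.IH[OF this] obtain f where f: "\<And>u. u \<in> A \<Longrightarrow> f u = f\<^sub>0 u"
    "\<And>u. u \<in> W \<Longrightarrow> \<bar>p u - sum_coord (f u)\<bar> < \<epsilon> \<and> \<bar>q u - diff_coord (f u)\<bar> < \<epsilon>"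
    "\<And>u v. u \<in> W \<Longrightarrow> v \<in> A \<union> W \<Longrightarrow> u \<noteq> v \<Longrightarrow> {f u, f v} \<notin> P"
    by blast
  have "finite (\<Union>u\<in>A \<union> W. {z. {f u, z} \<in> P})"
    using insert.hyps(1) assms(2) lf by blast
  with infinite_up_right_box[OF assms(4), of "p w" "q w"]
  have "infinite ({z. \<bar>p w - sum_coord z\<bar> < \<epsilon> \<and> \<bar>q w - diff_coord z\<bar> < \<epsilon>} - (\<Union>u\<in>A \<union> W. {z. {f u, z} \<in> P}))"
    by (rule Diff_infinite_finite[rotated])
  then obtain z where z: "\<bar>p w - sum_coord z\<bar> < \<epsilon>" "\<bar>q w - diff_coord z\<bar> < \<epsilon>"
    "\<And>u. u \<in> A \<union> W \<Longrightarrow> {f u, z} \<notin> P"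
    by (blast dest: infinite_imp_nonempty)
  have "w \<notin> A" "w \<notin> W" using insert by auto
  then show ?case
    using f z by (intro exI[of _ "f(w := z)"]) (auto simp: insert_commute)
qed

text \<open>The coordinates of the image points in \<open>U\<close> are themselves a plane placement
  of \<open>K\<close>.\<close>

lemma permutation_graph_if_copy:
  assumes "finite (verts K)" "inj_on f (verts K)"
    and "\<And>u v. u \<in> verts K \<Longrightarrow> v \<in> verts K \<Longrightarrow> u \<noteq> v \<Longrightarrow>
      {u, v} \<in> edges K \<longleftrightarrow> {f u, f v} \<in> edges up_right_graph"
  shows "permutation_graph K"
proof -
  have "inj_on (\<lambda>u. sum_coord (f u)) (verts K)" "inj_on (\<lambda>u. diff_coord (f u)) (verts K)"
    using assms(2) by (auto simp: inj_on_def inj_eq[OF inj_sum_coord] inj_eq[OF inj_diff_coord])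
  moreover have "{u, v} \<in> edges K \<longleftrightarrow> concordant (\<lambda>u. sum_coord (f u)) (\<lambda>u. diff_coord (f u)) u v"
    if "u \<in> verts K" "v \<in> verts K" "u \<noteq> v" for u v
    using assms(3)[OF that] by (simp add: edge_up_right_graph_iff_concordant concordant_def)
  ultimately show ?thesis
    unfolding permutation_graph_iff_concordant[OF assms(1)] by blast
qed

text \<open>Pinned vertices sit exactly on their targets and all others within
  \<open>\<epsilon>\<close> of them, with \<open>2 * \<epsilon>\<close> at most every gap in
  \<open>p\<close> and in \<open>q\<close>; hence all slope signs survive.\<close>

lemma up_right_embedding:
  fixes p q :: "'v \<Rightarrow> real" and f\<^sub>0 :: "'v \<Rightarrow> rat \<times> rat"
  assumes fin: "finite V" and p: "inj_on p V" and q: "inj_on q V" and "A \<subseteq> V"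
    and A: "\<And>u. u \<in> A \<Longrightarrow> sum_coord (f\<^sub>0 u) = p u \<and> diff_coord (f\<^sub>0 u) = q u"
    and lf: "\<And>x. finite {z. {x, z} \<in> P}"
  obtains f where "inj_on f V" "\<And>u. u \<in> A \<Longrightarrow> f u = f\<^sub>0 u"
    "\<And>u v. u \<in> V \<Longrightarrow> v \<in> V \<Longrightarrow> u \<noteq> v \<Longrightarrow> {f u, f v} \<in> edges up_right_graph \<longleftrightarrow> concordant p q u v"
    "\<And>u v. u \<in> V \<Longrightarrow> v \<in> V \<Longrightarrow> u \<noteq> v \<Longrightarrow> \<not> {u, v} \<subseteq> A \<Longrightarrow> {f u, f v} \<notin> P"
proof -
  obtain \<epsilon>1 where e1: "\<epsilon>1 > 0" "\<And>u v. u \<in> V \<Longrightarrow> v \<in> V \<Longrightarrow> u \<noteq> v \<Longrightarrow> 2 * \<epsilon>1 \<le> \<bar>p u - p v\<bar>"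
    using finite_inj_on_separated[OF fin p] by blast
  obtain \<epsilon>2 where e2: "\<epsilon>2 > 0" "\<And>u v. u \<in> V \<Longrightarrow> v \<in> V \<Longrightarrow> u \<noteq> v \<Longrightarrow> 2 * \<epsilon>2 \<le> \<bar>q u - q v\<bar>"
    using finite_inj_on_separated[OF fin q] by blast
  define \<epsilon> where "\<epsilon> = min \<epsilon>1 \<epsilon>2"
  have e: "\<epsilon> > 0"
    "\<And>u v. u \<in> V \<Longrightarrow> v \<in> V \<Longrightarrow> u \<noteq> v \<Longrightarrow> 2 * \<epsilon> \<le> \<bar>p u - p v\<bar> \<and> 2 * \<epsilon> \<le> \<bar>q u - q v\<bar>"
    using e1 e2 unfolding \<epsilon>_def by fastforce+
  have "finite A" using fin \<open>A \<subseteq> V\<close> finite_subset by blast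
  from placement_avoiding_pairs[of "V - A", OF finite_Diff[OF fin] this _ e(1) lf]
  obtain f where f: "\<And>u. u \<in> A \<Longrightarrow> f u = f\<^sub>0 u"
    "\<And>u. u \<in> V - A \<Longrightarrow> \<bar>p u - sum_coord (f u)\<bar> < \<epsilon> \<and> \<bar>q u - diff_coord (f u)\<bar> < \<epsilon>"
    "\<And>u v. u \<in> V - A \<Longrightarrow> v \<in> A \<union> (V - A) \<Longrightarrow> u \<noteq> v \<Longrightarrow> {f u, f v} \<notin> P"
    by (metis Diff_disjoint)
  have near: "\<bar>p u - sum_coord (f u)\<bar> < \<epsilon>" "\<bar>q u - diff_coord (f u)\<bar> < \<epsilon>" if "u \<in> V" for u
    using f(1,2)[of u] A[of u] e(1) that by (cases "u \<in> A"; auto)+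
  show ?thesis
  proof
    \<comment> \<open>A common image of two vertices would bring their \<open>p\<close>-values
      closer than \<open>2 * \<epsilon>\<close>.\<close>
    show "inj_on f V"
    proof (rule inj_onI, rule ccontr)
      fix u v assume "u \<in> V" "v \<in> V" "f u = f v" "u \<noteq> v"
      then show False
        using near(1)[of u] near(1)[of v] e(2)[of u v] by auto
    qed
    show "{f u, f v} \<in> edges up_right_graph \<longleftrightarrow> concordant p q u v"
      if uv: "u \<in> V" "v \<in> V" "u \<noteq> v" for u v
    proof -
      have "{f u, f v} \<in> edges up_right_graph \<longleftrightarrow>
          concordant (\<lambda>u. sum_coord (f u)) (\<lambda>u. diff_coord (f u)) u v"
        by (simp add: edge_up_right_graph_iff_concordant concordant_def)
      also have "\<dots> \<longleftrightarrow> concordant p q u v"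
        using near[OF uv(1)] near[OF uv(2)] e(2)[OF uv] by (intro concordant_cong_near) auto
      finally show ?thesis .
    qed
    show "{f u, f v} \<notin> P" if "u \<in> V" "v \<in> V" "u \<noteq> v" "\<not> {u, v} \<subseteq> A" for u v
      using f(3)[of u v] f(3)[of v u] that \<open>A \<subseteq> V\<close> by (auto simp: insert_commute)
  qed (use f(1) in auto)
qed

section \<open>Copies of \<open>H\<close> in \<open>U\<close> and in its perturbations\<close>

lemma verts_perturb [simp]: "verts (perturb G P) = verts G"
  by (simp add: perturb_def)

lemma edges_perturb_iff: "e \<in> edges (perturb G P) \<longleftrightarrow> (e \<in> edges G) \<noteq> (e \<in> P)"
  by (auto simp: perturb_def)

lemma verts_up_right_graph [simp]: "verts up_right_graph = UNIV"
  by (simp add: up_right_graph_def)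

lemma induced_free_up_right_graph_iff:
  assumes "finite_graph H"
  shows "induced_free H up_right_graph \<longleftrightarrow> \<not> permutation_graph H"
proof -
  have H: "simple_graph H" "finite (verts H)"
    using assms by (auto simp: finite_graph_def)
  have "permutation_graph H" if "contains_induced_copy up_right_graph H"
    using that permutation_graph_if_copy[OF H(2)] unfolding contains_induced_copy_iff by metis
  moreover have "contains_induced_copy up_right_graph H" if perm: "permutation_graph H"
  proof -
    obtain p q where pq: "inj_on p (verts H)" "inj_on q (verts H)"
      "\<And>u v. u \<in> verts H \<Longrightarrow> v \<in> verts H \<Longrightarrow> u \<noteq> v \<Longrightarrow> {u, v} \<in> edges H \<longleftrightarrow> concordant p q u v"
      using perm unfolding permutation_graph_iff_concordant[OF H(2)] by blast
    \<comment> \<open>The embedding is applied with nothing pinned and no pair to avoid;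
      \<open>undefined\<close> fills the place of the pinned positions.\<close>
    obtain f where "inj_on f (verts H)"
      "\<And>u v. u \<in> verts H \<Longrightarrow> v \<in> verts H \<Longrightarrow> u \<noteq> v \<Longrightarrow>
        {f u, f v} \<in> edges up_right_graph \<longleftrightarrow> concordant p q u v"
      by (rule up_right_embedding[OF H(2) pq(1,2), of "{}" undefined "{}"]) auto
    then show ?thesis
      using pq(3) by (intro contains_induced_copyI[OF simple_graph_up_right_graph H(1)]) auto
  qed
  ultimately show ?thesis
    unfolding induced_free_def by blast
qed

text \<open>A copy in the perturbed graph must use both ends of \<open>e0\<close>, since otherwise
  it would already lie in \<open>U\<close>. Undoing the perturbation toggles the corresponding pair
  of \<open>H\<close> and leaves an induced subgraph of \<open>U\<close>.\<close>

lemma permutation_graph_perturb_if_copy: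
  assumes H: "finite_graph H" and free: "induced_free H up_right_graph"
    and e0: "e0 \<in> vertex_pairs up_right_graph"
    and copy: "contains_induced_copy (perturb up_right_graph {e0}) H"
  shows "\<exists>e\<in>vertex_pairs H. (e \<in> edges H \<longleftrightarrow> e0 \<notin> edges up_right_graph) \<and>
    permutation_graph (perturb H {e})"
proof -
  obtain f where f: "inj_on f (verts H)"
    "\<And>u v. u \<in> verts H \<Longrightarrow> v \<in> verts H \<Longrightarrow>
      {u, v} \<in> edges H \<longleftrightarrow> {f u, f v} \<in> edges (perturb up_right_graph {e0})"
    using copy unfolding contains_induced_copy_iff by blast
  obtain u v where uv: "u \<in> verts H" "v \<in> verts H" "{f u, f v} = e0"
  proof (rule ccontr)
    assume "\<not> thesis"
    with that have "{f u, f v} \<noteq> e0" if "u \<in> verts H" "v \<in> verts H" for u v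
      using that by blast
    then have "contains_induced_copy up_right_graph H"
      unfolding contains_induced_copy_iff using f
      by (intro exI[of _ f]) (auto simp: edges_perturb_iff)
    with free show False by (simp add: induced_free_def)
  qed
  have "u \<noteq> v"
    using e0 by (auto simp: uv(3)[symmetric] vertex_pairs_doubleton_iff)
  have "permutation_graph (perturb H {{u, v}})"
  proof (rule permutation_graph_if_copy)
    fix w z assume wz: "w \<in> verts (perturb H {{u, v}})" "z \<in> verts (perturb H {{u, v}})"
    \<comment> \<open>By injectivity of \<open>f\<close>, \<open>{u, v}\<close> is the only pair of
      \<open>H\<close> mapped onto \<open>e0\<close>.\<close>
    have "{w, z} = {u, v} \<longleftrightarrow> {f w, f z} = {f u, f v}"
      using f(1) uv(1,2) wz by (auto simp: doubleton_eq_iff inj_on_eq_iff)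
    then show "{w, z} \<in> edges (perturb H {{u, v}}) \<longleftrightarrow> {f w, f z} \<in> edges up_right_graph"
      using f(2)[of w z] wz uv(3) by (auto simp: edges_perturb_iff)
  qed (use H f(1) in \<open>auto simp: finite_graph_def\<close>)
  moreover have "{u, v} \<in> edges H \<longleftrightarrow> e0 \<notin> edges up_right_graph"
    using f(2)[OF uv(1,2)] uv(3) by (simp add: edges_perturb_iff)
  moreover have "{u, v} \<in> vertex_pairs H"
    using uv \<open>u \<noteq> v\<close> by (simp add: vertex_pairs_doubleton_iff)
  ultimately show ?thesis by blast
qed

text \<open>\<open>perturb H {e}\<close> is embedded in \<open>U\<close> with \<open>e\<close>
  placed on \<open>e0\<close> and no other pair of its image in \<open>P\<close>. Perturbing by
  \<open>P\<close> then toggles exactly \<open>e\<close>, which restores \<open>H\<close>.\<close>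

lemma copy_if_permutation_graph_perturb:
  assumes H: "finite_graph H" and e: "e \<in> vertex_pairs H"
    and perm: "permutation_graph (perturb H {e})"
    and P: "P \<subseteq> vertex_pairs up_right_graph" and e0: "e0 \<in> P"
    and lf: "\<And>x. finite {d \<in> P. x \<in> d}"
    and parity: "e \<in> edges H \<longleftrightarrow> e0 \<notin> edges up_right_graph"
  shows "contains_induced_copy (perturb up_right_graph P) H"
proof -
  let ?V = "verts H"
  have fin: "finite ?V" "simple_graph H"
    using H by (auto simp: finite_graph_def)
  obtain u v where uv: "e = {u, v}" "u \<in> ?V" "v \<in> ?V" "u \<noteq> v"
    using e by (auto simp: vertex_pairs_def)
  obtain x y where xy: "e0 = {x, y}" "x \<noteq> y"
    using e0 P by (auto simp: vertex_pairs_def)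
  obtain p q where p: "inj_on p ?V" and q: "inj_on q ?V"
    and pq: "\<And>w z. w \<in> ?V \<Longrightarrow> z \<in> ?V \<Longrightarrow> w \<noteq> z \<Longrightarrow>
      {w, z} \<in> edges (perturb H {e}) \<longleftrightarrow> concordant p q w z"
    using perm permutation_graph_iff_concordant[of "perturb H {e}"] fin(1) by auto
  \<comment> \<open>\<open>c\<close> and \<open>d\<close> are the slopes of the affine maps of the
    two axes that carry the placement of \<open>u\<close>, \<open>v\<close> to \<open>x\<close>,
    \<open>y\<close>.\<close>
  define c where "c = (sum_coord x - sum_coord y) / (p u - p v)"
  define d where "d = (diff_coord x - diff_coord y) / (q u - q v)"
  define p' where "p' w = sum_coord x + c * (p w - p u)" for w
  define q' where "q' w = diff_coord x + d * (q w - q u)" for w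
  have ne: "p u \<noteq> p v" "q u \<noteq> q v" "sum_coord x \<noteq> sum_coord y" "diff_coord x \<noteq> diff_coord y"
    using p q uv(2-4) xy(2) by (auto simp: inj_on_eq_iff inj_eq[OF inj_sum_coord] inj_eq[OF inj_diff_coord])
  then have "c \<noteq> 0" "d \<noteq> 0"
    by (simp_all add: c_def d_def)
  let ?m = "(p u - p v) * (q u - q v)"
  let ?n = "(sum_coord x - sum_coord y) * (diff_coord x - diff_coord y)"
  \<comment> \<open>The parity assumption makes \<open>e\<close> an edge of
    \<open>perturb H {e}\<close> exactly when \<open>e0\<close> is an edge of \<open>U\<close>, so
    the two pairs have the same slope sign.\<close>
  have "concordant p q u v \<longleftrightarrow> concordant sum_coord diff_coord x y"
    using pq[OF uv(2-4)] parity uv(1) xy(1)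
    by (simp add: edges_perturb_iff edge_up_right_graph_iff_concordant)
  then have "0 < ?m \<longleftrightarrow> 0 < ?n"
    unfolding concordant_def .
  moreover have "?m \<noteq> 0" "?n \<noteq> 0"
    using ne by simp_all
  ultimately have "0 < ?n / ?m"
    by (metis linorder_cases zero_less_divide_iff)
  then have "0 < c * d"
    by (simp add: c_def d_def)
  \<comment> \<open>Each axis may be reversed separately, but \<open>0 < c * d\<close> means both
    are reversed or neither, which preserves every slope sign.\<close>
  have conc: "concordant p' q' w z \<longleftrightarrow> concordant p q w z" for w z
  proof -
    have "(p' w - p' z) * (q' w - q' z) = (c * d) * ((p w - p z) * (q w - q z))"
      by (simp add: p'_def q'_def algebra_simps)
    then show ?thesis
      unfolding concordant_def
      using mult_less_cancel_left_pos[OF \<open>0 < c * d\<close>, of 0 "(p w - p z) * (q w - q z)"]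
      by (simp only: mult_zero_right)
  qed
  have inj: "inj_on p' ?V" "inj_on q' ?V"
    using p q \<open>c \<noteq> 0\<close> \<open>d \<noteq> 0\<close> by (auto simp: inj_on_def p'_def q'_def)
  have pv: "p' v = sum_coord y" "q' v = diff_coord y"
    using ne by (simp_all add: p'_def q'_def c_def d_def field_simps)
  have "finite e'" if "e' \<in> P" for e'
    using that P by (auto simp: vertex_pairs_def)
  then have lf': "finite {z. {x, z} \<in> P}" for x
    by (rule finite_perturbed_neighbours[OF lf])
  define f0 where "f0 w = (if w = u then x else y)" for w
  obtain f where f: "inj_on f ?V" "\<And>w. w \<in> {u, v} \<Longrightarrow> f w = f0 w"
    "\<And>w z. w \<in> ?V \<Longrightarrow> z \<in> ?V \<Longrightarrow> w \<noteq> z \<Longrightarrow>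
      {f w, f z} \<in> edges up_right_graph \<longleftrightarrow> concordant p' q' w z"
    "\<And>w z. w \<in> ?V \<Longrightarrow> z \<in> ?V \<Longrightarrow> w \<noteq> z \<Longrightarrow> \<not> {w, z} \<subseteq> {u, v} \<Longrightarrow> {f w, f z} \<notin> P"
  proof (rule up_right_embedding[OF fin(1) inj, of "{u, v}" f0 P])
    show "sum_coord (f0 w) = p' w \<and> diff_coord (f0 w) = q' w" if "w \<in> {u, v}" for w
      using that pv uv(4) by (auto simp: f0_def p'_def q'_def)
  qed (use uv lf' in auto)
  have fuv: "{f u, f v} = e0"
    using f(2) uv(4) xy(1) by (simp add: f0_def)
  show ?thesis
  proof (rule contains_induced_copyI)
    show "simple_graph (perturb up_right_graph P)"
      using simple_graph_perturb[OF simple_graph_up_right_graph P] .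
    fix w z assume wz: "w \<in> ?V" "z \<in> ?V" "w \<noteq> z"
    have "{f w, f z} \<in> P \<longleftrightarrow> {w, z} = e"
    proof
      assume "{f w, f z} \<in> P"
      then have "{w, z} \<subseteq> {u, v}" using f(4) wz by blast
      with wz(3) uv(1) show "{w, z} = e" by auto
    next
      assume "{w, z} = e"
      then have "{f w, f z} = {f u, f v}" using uv(1) by (auto simp: doubleton_eq_iff)
      then show "{f w, f z} \<in> P" using fuv e0 by simp
    qed
    then show "{w, z} \<in> edges H \<longleftrightarrow> {f w, f z} \<in> edges (perturb up_right_graph P)"
      using f(3)[OF wz] conc pq[OF wz] by (auto simp: edges_perturb_iff)
  qed (use fin f(1) in auto)
qed

lemma perturb_singleton:
  "e \<in> edges H \<Longrightarrow> perturb H {e} = delete_edge H e"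
  "e \<notin> edges H \<Longrightarrow> perturb H {e} = add_edge H e"
  by (auto simp: perturb_def delete_edge_def add_edge_def)

theorem theorem7p2:
  fixes H :: "'h graph"
  assumes "finite_graph H"
  shows "strongly_induced_saturated H up_right_graph \<longleftrightarrow>
           \<not> permutation_graph H \<and>
           (\<exists>e\<in>edges H. permutation_graph (delete_edge H e)) \<and>
           (\<exists>e\<in>vertex_pairs H - edges H. permutation_graph (add_edge H e))"
    (is "_ \<longleftrightarrow> ?R")
proof
  assume sat: "strongly_induced_saturated H up_right_graph"
  then have free: "induced_free H up_right_graph"
    by (simp add: strongly_induced_saturated_def)
  \<comment> \<open>Saturation is used only for perturbations of a single pair.\<close>
  have ex: "\<exists>e\<in>vertex_pairs H. (e \<in> edges H \<longleftrightarrow> {x, y} \<notin> edges up_right_graph) \<and>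
      permutation_graph (perturb H {e})" if "x \<noteq> y" for x y
  proof (rule permutation_graph_perturb_if_copy[OF assms free])
    show pair: "{x, y} \<in> vertex_pairs up_right_graph"
      using that by (simp add: vertex_pairs_doubleton_iff)
    then have "locally_finite_perturbation up_right_graph (perturb up_right_graph {{x, y}})"
      unfolding locally_finite_perturbation_def by (intro exI[of _ "{{x, y}}"]) auto
    with sat show "contains_induced_copy (perturb up_right_graph {{x, y}}) H"
      by (simp add: strongly_induced_saturated_def)
  qed
  \<comment> \<open>One edge and one non-edge of \<open>U\<close> suffice: perturbing the edge
    yields the \<open>add_edge\<close> condition, perturbing the non-edge the
    \<open>delete_edge\<close> condition.\<close>
  have "{(0, 0), (1, 0)} \<in> edges up_right_graph" "{(0, 0), (0, 1)} \<notin> edges up_right_graph"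
    by (simp_all add: edge_up_right_graph_iff up_right_adjacent_def)
  with ex[of "(0, 0)" "(1, 0)"] ex[of "(0, 0)" "(0, 1)"] show ?R
    using induced_free_up_right_graph_iff[OF assms] free by (auto simp: perturb_singleton)
next
  assume R: ?R
  have sub: "edges H \<subseteq> vertex_pairs H"
    using assms by (simp add: finite_graph_def simple_graph_def)
  have "contains_induced_copy (perturb up_right_graph P) H"
    if P: "P \<subseteq> vertex_pairs up_right_graph" "e0 \<in> P" "\<And>x. finite {d \<in> P. x \<in> d}" for P e0
  proof -
    \<comment> \<open>Any \<open>e0\<close> from the nonempty set \<open>P\<close> will do. If it is
      an edge of \<open>U\<close>, it becomes a non-edge, so a non-edge of \<open>H\<close> is
      placed on it; otherwise an edge of \<open>H\<close> is.\<close>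
    obtain e where "e \<in> vertex_pairs H" "permutation_graph (perturb H {e})"
      "e \<in> edges H \<longleftrightarrow> e0 \<notin> edges up_right_graph"
    proof (cases "e0 \<in> edges up_right_graph")
      case True
      obtain e where "e \<in> vertex_pairs H - edges H" "permutation_graph (add_edge H e)"
        using R by blast
      with True that[of e] show ?thesis by (simp add: perturb_singleton)
    next
      case False
      obtain e where "e \<in> edges H" "permutation_graph (delete_edge H e)"
        using R by blast
      with False sub that[of e] show ?thesis by (auto simp: perturb_singleton)
    qed
    from copy_if_permutation_graph_perturb[OF assms this(1,2) P this(3)] show ?thesis .
  qed
  then show "strongly_induced_saturated H up_right_graph"
    using R induced_free_up_right_graph_iff[OF assms]
    unfolding strongly_induced_saturated_def locally_finite_perturbation_def by auto
qed

end
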